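(* Let $N\ge1$, $\mathbf h=[h_1,\dots,h_N]^T\in\mathbb C^N$ with all $h_i\ne0$, let $\sigma_\theta^2,\sigma_w^2,\sigma_{v,1}^2,\dots,\sigma_{v,N}^2,P>0$, and let $$\frac{P}{1+\left(\sum_{i=1}^N\frac1{\sigma_{v,i}^2}\right)P}<\epsilon<P .$$ Consider the semidefinite program $$\min_{\tilde{\mathbf A}}\ \mathrm{tr}(\tilde{\mathbf A}\mathbf T)\quad\text{s.t.}\quad \mathrm{tr}(\tilde{\mathbf A}\tilde{\mathbf E})-\left(\frac P\epsilon-1\right)\sigma_w^2\ge0,\quad \mathrm{tr}(\tilde{\mathbf A}\mathbf F_i)\le0\ (i=1,\dots,N),\quad\tilde{\mathbf A}\succeq0,$$ over Hermitian $(N+1)\times(N+1)$ matrices $\tilde{\mathbf A}$, where $\mathbf T,\tilde{\mathbf E},\mathbf F_i$ are the matrices given in the context. Let $\tilde{\mathbf A}^*$ be an optimal solution and let $\tilde{\mathbf A}^*_N$ be its leading principal $N\times N$ submatrix. Then $\tilde{\mathbf A}^*_N$ has rank one, $\tilde{\mathbf A}^*_N=\tilde{\mathbf a}\tilde{\mathbf a}^H$ for some $\tilde{\mathbf a}\in\mathbb C^N$, and $\mathbf a^*=\tilde{\mathbf a}$ is an optimal solution of the problem $$\min_{\mathbf a=[a_1,\dots,a_N]^H\in\mathbb C^N}\ \max_{1\le i\le N}\ |a_i|^2(\sigma_\theta^2+\sigma_{v,i}^2)\quad\text{s.t.}\quad \mathrm{MSE}(\mathbf a)\le\epsilon,$$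 where $$\mathrm{MSE}(\mathbf a)=\left(1-\frac{P\,\mathbf a^H\mathbf h\mathbf h^H\mathbf a}{\mathbf a^H\mathbf H\mathbf V\mathbf H^H\mathbf a+P\,\mathbf a^H\mathbf h\mathbf h^H\mathbf a+\sigma_w^2}\right)P .$$
   Context: $(\cdot)^H$ is the conjugate transpose. $\mathbf H=\mathrm{diag}\{h_1,\dots,h_N\}$, $\mathbf V=\mathrm{diag}\{\sigma_{v,1}^2,\dots,\sigma_{v,N}^2\}$, $\mathbf D_i$ is the $N\times N$ diagonal matrix whose only nonzero entry is $\sigma_\theta^2+\sigma_{v,i}^2$ in position $(i,i)$, and $\mathbf E=P\,\mathbf h\mathbf h^H-\left(\frac P\epsilon-1\right)\mathbf H\mathbf V\mathbf H^H$. The $(N+1)\times(N+1)$ matrices are $$\mathbf T=\begin{bmatrix}\mathbf 0&\mathbf 0\\ \mathbf 0^T&1\end{bmatrix},\quad\tilde{\mathbf E}=\begin{bmatrix}\mathbf E&\mathbf 0\\ \mathbf 0^T&0\end{bmatrix},\quad\mathbf F_i=\begin{bmatrix}\mathbf D_i&\mathbf 0\\ \mathbf 0^T&-1\end{bmatrix}.$$ Setting: $\mathrm{MSE}(\mathbf a)$ is the filtered Kalman MSE $P_{n|n}$ at a fusion center with prediction MSE $P=P_{n|n-1}$ and noise variance $\sigma_w^2$, and $|a_i|^2(\sigma_\theta^2+\sigma_{v,i}^2)$ is the transmit power of sensor $i$. *)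

theory Defs
  imports "Jordan_Normal_Form.DL_Rank"
begin

definition conj_transpose :: "complex mat \<Rightarrow> complex mat" where
  "conj_transpose A = map_mat cnj (transpose_mat A)"

definition mat_trace :: "complex mat \<Rightarrow> complex" where
  "mat_trace A = (\<Sum>i<dim_row A. A $$ (i, i))"

definition quad_form :: "complex mat \<Rightarrow> complex vec \<Rightarrow> complex" where
  "quad_form A x = conjugate x \<bullet> (A *\<^sub>v x)"

definition pos_semidef :: "nat \<Rightarrow> complex mat \<Rightarrow> bool" where
  "pos_semidef n A \<longleftrightarrow> A \<in> carrier_mat n n \<and> conj_transpose A = A \<and>
     (\<forall>x \<in> carrier_vec n. Re (quad_form A x) \<ge> 0)"

definition outer_self :: "complex vec \<Rightarrow> complex mat" where
  "outer_self v = mat (dim_vec v) (dim_vec v) (\<lambda>(i, j). v $ i * cnj (v $ j))"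

definition leading_principal :: "nat \<Rightarrow> complex mat \<Rightarrow> complex mat" where
  "leading_principal n A = mat n n (\<lambda>(i, j). A $$ (i, j))"

text \<open>
  Sensors are indexed by \<open>0, \<dots>, N - 1\<close>. The parameters \<open>vth\<close>, \<open>vw\<close> and \<open>vv i\<close> are
  the variances \<open>\<sigma>\<^sub>\<theta>\<^sup>2\<close>, \<open>\<sigma>\<^sub>w\<^sup>2\<close> and \<open>\<sigma>\<^sub>v\<^sub>,\<^sub>i\<^sup>2\<close> themselves, not their square roots.
\<close>

definition HVH_mat :: "nat \<Rightarrow> complex vec \<Rightarrow> (nat \<Rightarrow> real) \<Rightarrow> complex mat" where
  "HVH_mat N h vv =
     mat_diag N (\<lambda>i. h $ i) * mat_diag N (\<lambda>i. complex_of_real (vv i)) *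
       conj_transpose (mat_diag N (\<lambda>i. h $ i))"

definition D_mat :: "nat \<Rightarrow> real \<Rightarrow> (nat \<Rightarrow> real) \<Rightarrow> nat \<Rightarrow> complex mat" where
  "D_mat N vth vv i = mat_diag N (\<lambda>j. if j = i then complex_of_real (vth + vv i) else 0)"

definition E_mat ::
    "nat \<Rightarrow> complex vec \<Rightarrow> (nat \<Rightarrow> real) \<Rightarrow> real \<Rightarrow> real \<Rightarrow> complex mat" where
  "E_mat N h vv P eps =
     complex_of_real P \<cdot>\<^sub>m outer_self h - complex_of_real (P / eps - 1) \<cdot>\<^sub>m HVH_mat N h vv"

definition T_mat :: "nat \<Rightarrow> complex mat" where
  "T_mat N = four_block_mat (0\<^sub>m N N) (0\<^sub>m N 1) (0\<^sub>m 1 N) (1\<^sub>m 1)"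

definition E_tilde ::
    "nat \<Rightarrow> complex vec \<Rightarrow> (nat \<Rightarrow> real) \<Rightarrow> real \<Rightarrow> real \<Rightarrow> complex mat" where
  "E_tilde N h vv P eps =
     four_block_mat (E_mat N h vv P eps) (0\<^sub>m N 1) (0\<^sub>m 1 N) (0\<^sub>m 1 1)"

definition F_mat :: "nat \<Rightarrow> real \<Rightarrow> (nat \<Rightarrow> real) \<Rightarrow> nat \<Rightarrow> complex mat" where
  "F_mat N vth vv i = four_block_mat (D_mat N vth vv i) (0\<^sub>m N 1) (0\<^sub>m 1 N) (- 1\<^sub>m 1)"

text \<open>
  All traces and quadratic forms below involve Hermitian matrices only, so they are real
  and \<open>Re\<close> merely changes their type.
\<close>

definition sdp_objective :: "nat \<Rightarrow> complex mat \<Rightarrow> real" where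
  "sdp_objective N A = Re (mat_trace (A * T_mat N))"

definition sdp_feasible ::
    "nat \<Rightarrow> complex vec \<Rightarrow> real \<Rightarrow> real \<Rightarrow> (nat \<Rightarrow> real) \<Rightarrow> real \<Rightarrow> real \<Rightarrow> complex mat \<Rightarrow> bool" where
  "sdp_feasible N h vth vw vv P eps A \<longleftrightarrow>
     Re (mat_trace (A * E_tilde N h vv P eps)) - (P / eps - 1) * vw \<ge> 0 \<and>
     (\<forall>i<N. Re (mat_trace (A * F_mat N vth vv i)) \<le> 0) \<and>
     pos_semidef (N + 1) A"

definition MSE ::
    "nat \<Rightarrow> complex vec \<Rightarrow> real \<Rightarrow> (nat \<Rightarrow> real) \<Rightarrow> real \<Rightarrow> complex vec \<Rightarrow> real" where
  "MSE N h vw vv P a =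
     (1 - P * Re (quad_form (outer_self h) a) /
          (Re (quad_form (HVH_mat N h vv) a) + P * Re (quad_form (outer_self h) a) + vw)) * P"

text \<open>
  The vector \<open>a\<close> is the conjugate transpose of the row of sensor gains, i.e. \<open>a $ i\<close> is the
  conjugate of the gain of sensor \<open>i\<close>; the modulus is the same.
\<close>

definition max_power :: "nat \<Rightarrow> real \<Rightarrow> (nat \<Rightarrow> real) \<Rightarrow> complex vec \<Rightarrow> real" where
  "max_power N vth vv a = Max ((\<lambda>i. (cmod (a $ i))\<^sup>2 * (vth + vv i)) ` {..<N})"

end

theory Submission
  imports Defs
begin

text \<open>
  Let \<open>X\<close> be the leading block of the optimal matrix and \<open>t\<close> its last diagonal entry. Put
  \<open>c\<^sub>i = sqrt X\<^sub>i\<^sub>i\<close> and align phases with the channel: \<open>a\<^sub>i = c\<^sub>i h\<^sub>i / |h\<^sub>i|\<close>. Positive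
  semidefiniteness gives \<open>|X\<^sub>i\<^sub>j| \<le> c\<^sub>i c\<^sub>j\<close>, so replacing \<open>X\<close> by \<open>a a\<^sup>H\<close> keeps the diagonal and can
  only increase \<open>h\<^sup>H X h\<close>. A strict increase would leave slack in the first constraint, and
  scaling down would lower \<open>t\<close>. Hence equality holds in every term, and as no \<open>h\<^sub>i\<close> vanishes
  this forces \<open>X = a a\<^sup>H\<close>. Optimality of \<open>a\<close> follows because every \<open>b\<close> with MSE at most
  \<open>eps\<close> lifts to a feasible matrix whose objective value is the largest sensor power of \<open>b\<close>.
\<close>

section \<open>Quadratic forms, traces and outer products in coordinates\<close>

lemma quad_form_sum:
  assumes "A \<in> carrier_mat n n" "x \<in> carrier_vec n"
  shows "quad_form A x = (\<Sum>i<n. \<Sum>j<n. cnj (x $ i) * A $$ (i, j) * x $ j)"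
  using assms
  by (auto simp: quad_form_def scalar_prod_def sum_distrib_left mult.assoc lessThan_atLeast0
      intro!: sum.cong)

lemma mat_trace_mult:
  assumes "A \<in> carrier_mat n n" "B \<in> carrier_mat n n"
  shows "mat_trace (A * B) = (\<Sum>i<n. \<Sum>j<n. A $$ (i, j) * B $$ (j, i))"
  using assms
  by (auto simp: mat_trace_def scalar_prod_def lessThan_atLeast0 intro!: sum.cong)

lemma outer_self_carrier [simp]: "v \<in> carrier_vec n \<Longrightarrow> outer_self v \<in> carrier_mat n n"
  by (auto simp: outer_self_def)

lemma outer_self_dim [simp]: "dim_row (outer_self v) = dim_vec v" "dim_col (outer_self v) = dim_vec v"
  by (simp_all add: outer_self_def)

lemma outer_self_index [simp]:
  "v \<in> carrier_vec n \<Longrightarrow> i < n \<Longrightarrow> j < n \<Longrightarrow> outer_self v $$ (i, j) = v $ i * cnj (v $ j)"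
  by (auto simp: outer_self_def)

text \<open>The double sum factors as z times its conjugate. Functions instead of vectors allow
  \<open>x\<close> to be a vector with more than \<open>n\<close> entries, as in
  \<open>pos_semidef_lift\<close>.\<close>

lemma sum_outer_cmod:
  "(\<Sum>i<(n::nat). \<Sum>j<n. cnj (x i) * (v i * cnj (v j)) * x j)
     = complex_of_real ((cmod (\<Sum>i<n. cnj (x i) * v i))\<^sup>2)"
proof -
  have "(\<Sum>i<n. \<Sum>j<n. cnj (x i) * (v i * cnj (v j)) * x j)
      = (\<Sum>i<n. cnj (x i) * v i) * cnj (\<Sum>i<n. cnj (x i) * v i)"
    by (simp add: sum_product mult_ac)
  then show ?thesis
    by (simp only: complex_norm_square)
qed

lemma quad_form_outer_self:
  assumes "v \<in> carrier_vec n" "x \<in> carrier_vec n"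
  shows "quad_form (outer_self v) x = complex_of_real ((cmod (\<Sum>i<n. cnj (x $ i) * v $ i))\<^sup>2)"
  using assms by (simp add: quad_form_sum[of _ n] sum_outer_cmod)

lemma HVH_mat_eq:
  "HVH_mat N h vv = mat_diag N (\<lambda>i. complex_of_real ((cmod (h $ i))\<^sup>2 * vv i))"
proof -
  have "conj_transpose (mat_diag N (\<lambda>i. h $ i)) = mat_diag N (\<lambda>i. cnj (h $ i))"
    by (auto simp: conj_transpose_def mat_diag_def)
  then show ?thesis
    by (simp add: HVH_mat_def complex_norm_square mult_ac del: of_real_power)
qed

lemma quad_form_HVH:
  assumes "x \<in> carrier_vec N"
  shows "Re (quad_form (HVH_mat N h vv) x) = (\<Sum>i<N. (cmod (h $ i))\<^sup>2 * vv i * (cmod (x $ i))\<^sup>2)"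
proof -
  have "quad_form (HVH_mat N h vv) x
      = (\<Sum>i<N. \<Sum>j<N. if i = j then cnj (x $ i) * ((cmod (h $ i))\<^sup>2 * vv i) * x $ i else 0)"
    unfolding HVH_mat_eq using assms
    by (subst quad_form_sum[of _ N]) (simp_all add: mat_diag_def if_distrib[of "\<lambda>y. y * _"]
        if_distrib[of "(*) _"] cong: if_cong)
  also have "\<dots> = (\<Sum>i<N. complex_of_real ((cmod (h $ i))\<^sup>2 * vv i * (cmod (x $ i))\<^sup>2))"
    by (simp add: complex_norm_square mult_ac del: of_real_power)
  finally show ?thesis by simp
qed

section \<open>Objective and constraints of the semidefinite program in terms of entries\<close>

lemma sdp_objective_eq:
  assumes "A \<in> carrier_mat (N + 1) (N + 1)"
  shows "sdp_objective N A = Re (A $$ (N, N))"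
proof -
  have T: "T_mat N \<in> carrier_mat (N + 1) (N + 1)"
    by (auto simp: T_mat_def)
  have "T_mat N $$ (j, i) = (if i = N \<and> j = N then 1 else 0)" if "i < N + 1" "j < N + 1" for i j
    using that by (auto simp: T_mat_def)
  then have "mat_trace (A * T_mat N)
      = (\<Sum>i<N + 1. \<Sum>j<N + 1. if i = N \<and> j = N then A $$ (i, j) else 0)"
    unfolding mat_trace_mult[OF assms T] by (intro sum.cong) auto
  also have "\<dots> = A $$ (N, N)"
    by (simp add: sum.neutral)
  finally show ?thesis by (simp add: sdp_objective_def)
qed

text \<open>Together with \<open>sdp_objective_eq\<close> this exhibits the program as an epigraph
  form: the last diagonal entry is an upper bound for all sensor powers, and it is
  minimised.\<close>

lemma trace_F_mat:
  assumes "A \<in> carrier_mat (N + 1) (N + 1)" "k < N"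
  shows "Re (mat_trace (A * F_mat N vth vv k)) = Re (A $$ (k, k)) * (vth + vv k) - Re (A $$ (N, N))"
proof -
  have F: "F_mat N vth vv k \<in> carrier_mat (N + 1) (N + 1)"
    by (auto simp: F_mat_def D_mat_def mat_diag_def)
  have "F_mat N vth vv k $$ (j, i)
      = (if j = i then (if i = k then complex_of_real (vth + vv k) else if i = N then - 1 else 0) else 0)"
    if "i < N + 1" "j < N + 1" for i j
    using that assms(2) by (auto simp: F_mat_def D_mat_def mat_diag_def)
  then have "mat_trace (A * F_mat N vth vv k)
      = (\<Sum>i<N + 1. \<Sum>j<N + 1. if j = i then
          (if i = k then A $$ (i, i) * complex_of_real (vth + vv k)
           else if i = N then - A $$ (i, i) else 0) else 0)"
    unfolding mat_trace_mult[OF assms(1) F] by (intro sum.cong) auto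
  also have "\<dots> = (\<Sum>i<N + 1. if i = k then A $$ (i, i) * complex_of_real (vth + vv k)
           else if i = N then - A $$ (i, i) else 0)"
    by (simp only: sum.delta finite_lessThan) (auto intro!: sum.cong)
  also have "\<dots> = (\<Sum>i<N. if i = k then A $$ (i, i) * complex_of_real (vth + vv k) else 0) - A $$ (N, N)"
  proof -
    have "(\<Sum>i<N. if i = k then A $$ (i, i) * complex_of_real (vth + vv k)
            else if i = N then - A $$ (i, i) else 0)
        = (\<Sum>i<N. if i = k then A $$ (i, i) * complex_of_real (vth + vv k) else 0)"
      by (intro sum.cong) auto
    then show ?thesis using assms(2) by simp
  qed
  also have "\<dots> = A $$ (k, k) * complex_of_real (vth + vv k) - A $$ (N, N)"
    using assms(2) by simp
  finally show ?thesis by simp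
qed

text \<open>Off-diagonal entries of \<open>A\<close> occur only in the first sum, the real part of
  h^H X h for the leading block X. Changing X without changing its diagonal therefore affects that
  sum alone.\<close>

lemma trace_E_tilde:
  assumes "A \<in> carrier_mat (N + 1) (N + 1)" "h \<in> carrier_vec N"
  shows "Re (mat_trace (A * E_tilde N h vv P eps))
    = P * (\<Sum>i<N. \<Sum>j<N. Re (cnj (h $ i) * A $$ (i, j) * h $ j))
      - (P / eps - 1) * (\<Sum>i<N. (cmod (h $ i))\<^sup>2 * vv i * Re (A $$ (i, i)))"
proof -
  let ?k = "P / eps - 1"
  have EN: "E_mat N h vv P eps \<in> carrier_mat N N"
    using assms(2) by (auto simp: E_mat_def HVH_mat_eq mat_diag_def)
  then have E: "E_tilde N h vv P eps \<in> carrier_mat (N + 1) (N + 1)"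
    by (auto simp: E_tilde_def)
  have Eij: "E_tilde N h vv P eps $$ (j, i) = complex_of_real P * (h $ j * cnj (h $ i))
      - (if j = i then complex_of_real (?k * ((cmod (h $ i))\<^sup>2 * vv i)) else 0)"
    if "i < N" "j < N" for i j
    using that assms(2) EN
    by (auto simp: E_tilde_def E_mat_def HVH_mat_eq mat_diag_def outer_self_def)
  have E0: "E_tilde N h vv P eps $$ (j, i) = 0" if "i < N + 1" "j < N + 1" "i = N \<or> j = N" for i j
    using that EN by (auto simp: E_tilde_def)
  have "mat_trace (A * E_tilde N h vv P eps)
      = (\<Sum>i<N. \<Sum>j<N. A $$ (i, j) * E_tilde N h vv P eps $$ (j, i))"
    unfolding mat_trace_mult[OF assms(1) E] by (simp add: E0)
  also have "Re \<dots> = (\<Sum>i<N. \<Sum>j<N. P * Re (cnj (h $ i) * A $$ (i, j) * h $ j)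
      - (if j = i then ?k * ((cmod (h $ i))\<^sup>2 * vv i * Re (A $$ (i, i))) else 0))"
    unfolding Re_sum
  proof (intro sum.cong refl)
    fix i j assume "i \<in> {..<N}" "j \<in> {..<N}"
    then have "A $$ (i, j) * E_tilde N h vv P eps $$ (j, i)
      = complex_of_real P * (cnj (h $ i) * A $$ (i, j) * h $ j)
        - (if j = i then complex_of_real (?k * ((cmod (h $ i))\<^sup>2 * vv i)) * A $$ (i, i) else 0)"
      by (auto simp: Eij algebra_simps)
    then show "Re (A $$ (i, j) * E_tilde N h vv P eps $$ (j, i))
      = P * Re (cnj (h $ i) * A $$ (i, j) * h $ j)
        - (if j = i then ?k * ((cmod (h $ i))\<^sup>2 * vv i * Re (A $$ (i, i))) else 0)"
      \<comment> \<open>The product rule for \<open>Re\<close> is instantiated to a real left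
        factor, so that \<open>Re (cnj (h $ i) * A $$ (i, j) * h $ j)\<close> is not
        expanded.\<close>
      by (simp only: minus_complex.sel Re_complex_of_real mult.assoc if_distrib[of Re]
          times_complex.sel(1)[of "complex_of_real _"] Im_complex_of_real zero_complex.sel) simp
  qed
  also have "\<dots> = P * (\<Sum>i<N. \<Sum>j<N. Re (cnj (h $ i) * A $$ (i, j) * h $ j))
      - ?k * (\<Sum>i<N. (cmod (h $ i))\<^sup>2 * vv i * Re (A $$ (i, i)))"
    by (simp only: sum_subtractf sum_distrib_left[symmetric] sum.delta finite_lessThan)
       (simp add: sum_distrib_left)
  finally show ?thesis .
qed

section \<open>Positive semidefinite matrices and the rank of outer products\<close>

lemma pos_semidef_hermitian:
  assumes "pos_semidef n A" "i < n" "j < n"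
  shows "A $$ (j, i) = cnj (A $$ (i, j))"
proof -
  have A: "A \<in> carrier_mat n n"
    using assms(1) by (simp add: pos_semidef_def)
  have "conj_transpose A $$ (j, i) = cnj (A $$ (i, j))"
    using A assms(2,3) by (simp add: conj_transpose_def)
  then show ?thesis using assms by (simp add: pos_semidef_def)
qed

text \<open>Evaluate the form at a vector supported on \<open>{i, j}\<close> with entries
  \<open>r\<close> and \<open>s\<close>. The two cross terms are conjugate because \<open>A\<close>
  is Hermitian, hence the factor 2.\<close>

lemma pos_semidef_two_by_two:
  fixes r s :: complex
  assumes "pos_semidef n A" "i < n" "j < n" "i \<noteq> j"
  shows "0 \<le> (cmod r)\<^sup>2 * Re (A $$ (i, i)) + (cmod s)\<^sup>2 * Re (A $$ (j, j))
    + 2 * Re (cnj r * A $$ (i, j) * s)"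
proof -
  define x where "x = vec n (\<lambda>k. if k = i then r else if k = j then s else 0)"
  have A: "A \<in> carrier_mat n n" and x: "x \<in> carrier_vec n"
    using assms(1) by (auto simp: pos_semidef_def x_def)
  have split: "(\<Sum>k<n. f k) = f i + f j" if "\<And>k. k < n \<Longrightarrow> k \<noteq> i \<Longrightarrow> k \<noteq> j \<Longrightarrow> f k = 0"
    for f :: "nat \<Rightarrow> complex"
  proof -
    have "(\<Sum>k<n. f k) = (\<Sum>k\<in>{i, j}. f k)"
      by (rule sum.mono_neutral_right) (use assms that in auto)
    then show ?thesis using assms by simp
  qed
  have xi: "x $ i = r" "x $ j = s" "\<And>k. k < n \<Longrightarrow> k \<noteq> i \<Longrightarrow> k \<noteq> j \<Longrightarrow> x $ k = 0"
    using assms by (auto simp: x_def)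
  have "quad_form A x = cnj r * A $$ (i, i) * r + cnj r * A $$ (i, j) * s
      + (cnj s * A $$ (j, i) * r + cnj s * A $$ (j, j) * s)"
    unfolding quad_form_sum[OF A x] by (subst split; simp add: xi)+
  moreover have "Re (cnj s * A $$ (j, i) * r) = Re (cnj r * A $$ (i, j) * s)"
    unfolding pos_semidef_hermitian[OF assms(1-3)] by (simp add: algebra_simps)
  moreover have "Re (cnj z * w * z) = (cmod z)\<^sup>2 * Re w" for z w
    unfolding cmod_power2 by (simp add: algebra_simps power2_eq_square)
  moreover have "Re (quad_form A x) \<ge> 0"
    using assms(1) x by (auto simp: pos_semidef_def)
  ultimately show ?thesis by (simp only: plus_complex.sel)
qed

lemma pos_semidef_diag:
  assumes "pos_semidef n A" "i < n"
  shows "0 \<le> Re (A $$ (i, i))" "A $$ (i, i) = complex_of_real (Re (A $$ (i, i)))"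
proof -
  have A: "A \<in> carrier_mat n n"
    using assms(1) by (auto simp: pos_semidef_def)
  have "quad_form A (unit_vec n i) = A $$ (i, i)"
    using assms(2) A
    by (simp add: quad_form_sum[OF A] if_distrib[of cnj] if_distrib[of "\<lambda>x. x * _"] if_distrib[of "(*) _"]
        cong: if_cong)
  moreover have "Re (quad_form A (unit_vec n i)) \<ge> 0"
    using assms(1) by (auto simp: pos_semidef_def)
  ultimately show "0 \<le> Re (A $$ (i, i))" by simp
  show "A $$ (i, i) = complex_of_real (Re (A $$ (i, i)))"
    using pos_semidef_hermitian[OF assms(1) assms(2) assms(2)]
    by (simp add: complex_eq_iff)
qed

text \<open>This is nonnegativity of the 2 by 2 principal minors, obtained by a discriminant
  argument in one real parameter.\<close>

lemma pos_semidef_offdiag: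
  assumes "pos_semidef n A" "i < n" "j < n"
  shows "cmod (A $$ (i, j)) \<le> sqrt (Re (A $$ (i, i))) * sqrt (Re (A $$ (j, j)))"
proof (cases "i = j")
  case True
  then show ?thesis
    using pos_semidef_diag[OF assms(1,2)] by (metis abs_of_nonneg norm_of_real order.refl
        real_sqrt_mult_self)
next
  case False
  define a c m where "a = Re (A $$ (i, i))" and "c = Re (A $$ (j, j))" and "m = cmod (A $$ (i, j))"
  have nonneg: "a \<ge> 0" "c \<ge> 0" "m \<ge> 0"
    using pos_semidef_diag(1) assms by (auto simp: a_def c_def m_def)
  have "m\<^sup>2 \<le> a * c"
  proof (cases "m = 0")
    case False
    then have m: "m > 0" using nonneg by simp
    have disc: "2 * t * m\<^sup>2 \<le> t\<^sup>2 * m\<^sup>2 * a + c" for t :: real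
    \<comment> \<open>The choice r = t A_ij, s = -1 turns the cross term into the real number -2 t
      m^2, whatever the phase of A_ij.\<close>
    proof -
      have "Re (cnj (complex_of_real t * A $$ (i, j)) * A $$ (i, j) * (- 1)) = - t * m\<^sup>2"
        unfolding m_def cmod_power2 by (simp add: algebra_simps power2_eq_square)
      then show ?thesis
        using pos_semidef_two_by_two[OF assms \<open>i \<noteq> j\<close>, of "complex_of_real t * A $$ (i, j)" "- 1"]
        by (simp add: norm_mult power_mult_distrib a_def c_def m_def)
    qed
    show ?thesis
    proof (cases "a = 0")
      case True
      \<comment> \<open>With a = 0 the bound is linear in t; this t yields 2 (c + 1) \<le> c, which
        is impossible for c \<ge> 0.\<close>
      have "2 * ((c + 1) / m\<^sup>2) * m\<^sup>2 \<le> c"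
        using disc[of "(c + 1) / m\<^sup>2"] True by simp
      then show ?thesis using m nonneg by simp
    next
      case False
      then have a: "a > 0" using nonneg by simp
      \<comment> \<open>t = 1/a minimises the quadratic; after multiplication by a it reads 2 m^2
        \<le> m^2 + a c.\<close>
      have "a * (2 * (1 / a) * m\<^sup>2) \<le> a * ((1 / a)\<^sup>2 * m\<^sup>2 * a + c)"
        using disc[of "1 / a"] a by (intro mult_left_mono) auto
      then show ?thesis using a by (simp add: power2_eq_square field_simps)
    qed
  qed (use nonneg in simp)
  then have "m \<le> sqrt (a * c)"
    using nonneg by (simp add: real_le_rsqrt)
  then show ?thesis by (simp add: real_sqrt_mult a_def c_def m_def)
qed

text \<open>The rank is at most one because the entries are products of a row factor and a column
  factor. It is at least one because column k with v_k nonzero has the nonzero entry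
  |v_k|^2.\<close>

lemma rank_outer_self:
  assumes "v \<in> carrier_vec n" "v \<noteq> 0\<^sub>v n"
  shows "vec_space.rank n (outer_self v) = 1"
proof -
  interpret vec_space "TYPE(complex)" n .
  let ?A = "outer_self v"
  have A: "?A \<in> carrier_mat n n" using assms by simp
  obtain k where k: "k < n" "v $ k \<noteq> 0"
    using assms by (metis carrier_vecD eq_vecI index_zero_vec)
  let ?c = "col ?A k"
  have c: "?c \<in> carrier_vec n" using A k by auto
  have "?c $ k = v $ k * cnj (v $ k)" using assms k by (auto simp: col_def)
  then have "?c $ k \<noteq> 0" using k by simp
  then have c0: "?c \<noteq> 0\<^sub>v n" using k by auto
  have "lin_indpt {?c}"
    using lin_dep_iff_in_span[of "{}" ?c] c c0 span_empty lin_dep_def by auto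
  moreover have "{?c} \<subseteq> set (cols ?A)"
    using A k by (auto simp: cols_def)
  ultimately have "1 \<le> rank ?A"
    using rank_ge_card_indpt[OF A, of "{?c}"] by simp
  moreover have "rank ?A \<le> 1"
    by (rule rank_le_1_product_entries[OF A, of "\<lambda>i. v $ i" "\<lambda>j. cnj (v $ j)"])
      (use assms A in auto)
  ultimately show ?thesis by simp
qed

section \<open>Lifting gain vectors to the semidefinite program\<close>

definition lift_mat :: "nat \<Rightarrow> complex vec \<Rightarrow> real \<Rightarrow> complex mat" where
  "lift_mat N a t =
     four_block_mat (outer_self a) (0\<^sub>m N 1) (0\<^sub>m 1 N) (complex_of_real t \<cdot>\<^sub>m 1\<^sub>m 1)"

text \<open>This is the quadratic form a^H E a of \<open>E_mat\<close>, to be compared with the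
  threshold \<open>(P / eps - 1) * vw\<close>.\<close>

definition snr_margin ::
    "nat \<Rightarrow> complex vec \<Rightarrow> (nat \<Rightarrow> real) \<Rightarrow> real \<Rightarrow> real \<Rightarrow> complex vec \<Rightarrow> real" where
  "snr_margin N h vv P eps a =
     P * (cmod (\<Sum>i<N. cnj (h $ i) * a $ i))\<^sup>2
       - (P / eps - 1) * (\<Sum>i<N. (cmod (h $ i))\<^sup>2 * vv i * (cmod (a $ i))\<^sup>2)"

context
  fixes N :: nat and a :: "complex vec"
  assumes a: "a \<in> carrier_vec N"
begin

lemma lift_mat_carrier: "lift_mat N a t \<in> carrier_mat (N + 1) (N + 1)"
  unfolding lift_mat_def using a by (intro four_block_carrier_mat) auto

lemma lift_mat_index:
  assumes "i < N + 1" "j < N + 1"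
  shows "lift_mat N a t $$ (i, j) = (if i < N \<and> j < N then a $ i * cnj (a $ j)
    else if i = j then complex_of_real t else 0)"
  using a assms by (auto simp: lift_mat_def outer_self_def)

lemma sdp_objective_lift: "sdp_objective N (lift_mat N a t) = t"
  by (simp add: sdp_objective_eq[OF lift_mat_carrier] lift_mat_index)

lemma pos_semidef_lift:
  assumes "t \<ge> 0"
  shows "pos_semidef (N + 1) (lift_mat N a t)"
  unfolding pos_semidef_def
proof (intro conjI ballI)
  show "lift_mat N a t \<in> carrier_mat (N + 1) (N + 1)"
    by (rule lift_mat_carrier)
  show "conj_transpose (lift_mat N a t) = lift_mat N a t"
    using lift_mat_carrier[of t] by (auto simp: conj_transpose_def lift_mat_index)
  fix x :: "complex vec" assume x: "x \<in> carrier_vec (N + 1)"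
  have "quad_form (lift_mat N a t) x
      = (\<Sum>i<N. \<Sum>j<N. cnj (x $ i) * (a $ i * cnj (a $ j)) * x $ j) + cnj (x $ N) * t * x $ N"
    unfolding quad_form_sum[OF lift_mat_carrier x] by (simp add: lift_mat_index)
  also have "\<dots> = complex_of_real ((cmod (\<Sum>i<N. cnj (x $ i) * a $ i))\<^sup>2 + t * (cmod (x $ N))\<^sup>2)"
    unfolding sum_outer_cmod by (simp add: complex_norm_square mult_ac del: of_real_power)
  finally show "Re (quad_form (lift_mat N a t) x) \<ge> 0"
    using assms by simp
qed

text \<open>On lifted vectors the program becomes the scalar problem in epigraph form, with
  \<open>t\<close> bounding all powers. Every construction of a feasible competitor goes through
  this equivalence.\<close>

lemma sdp_feasible_lift:
  assumes "h \<in> carrier_vec N" "t \<ge> 0"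
  shows "sdp_feasible N h vth vw vv P eps (lift_mat N a t) \<longleftrightarrow>
    (P / eps - 1) * vw \<le> snr_margin N h vv P eps a \<and>
    (\<forall>i<N. (cmod (a $ i))\<^sup>2 * (vth + vv i) \<le> t)"
proof -
  have "(\<Sum>i<N. \<Sum>j<N. Re (cnj (h $ i) * lift_mat N a t $$ (i, j) * h $ j))
      = (cmod (\<Sum>i<N. cnj (h $ i) * a $ i))\<^sup>2"
  proof -
    have "(\<Sum>i<N. \<Sum>j<N. Re (cnj (h $ i) * lift_mat N a t $$ (i, j) * h $ j))
        = (\<Sum>i<N. \<Sum>j<N. Re (cnj (h $ i) * (a $ i * cnj (a $ j)) * h $ j))"
      by (intro sum.cong refl) (simp add: lift_mat_index)
    also have "\<dots> = Re (complex_of_real ((cmod (\<Sum>i<N. cnj (h $ i) * a $ i))\<^sup>2))"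
      unfolding sum_outer_cmod[symmetric] Re_sum ..
    finally show ?thesis by simp
  qed
  moreover have diag: "Re (lift_mat N a t $$ (i, i)) = (cmod (a $ i))\<^sup>2" if "i < N" for i
    using that by (simp only: lift_mat_index complex_norm_square[symmetric]) simp
  ultimately have "Re (mat_trace (lift_mat N a t * E_tilde N h vv P eps))
      = snr_margin N h vv P eps a"
    by (simp add: trace_E_tilde[OF lift_mat_carrier assms(1)] snr_margin_def)
  moreover have "Re (mat_trace (lift_mat N a t * F_mat N vth vv i))
      = (cmod (a $ i))\<^sup>2 * (vth + vv i) - t" if "i < N" for i
    using that by (simp add: trace_F_mat[OF lift_mat_carrier] diag) (simp add: lift_mat_index)
  ultimately show ?thesis
    unfolding sdp_feasible_def using pos_semidef_lift[OF assms(2)] by auto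
qed

text \<open>With Q = a^H H V H^H a and R = |h^H a|^2 the MSE is (Q + vw) P / (Q + P R + vw).
  Clearing the positive denominator and dividing by \<open>eps\<close> leaves an inequality linear
  in Q and R.\<close>

lemma MSE_le_iff:
  assumes "h \<in> carrier_vec N" "\<forall>i<N. vv i > 0" "vw > 0" "P > 0" "eps > 0"
  shows "MSE N h vw vv P a \<le> eps \<longleftrightarrow> (P / eps - 1) * vw \<le> snr_margin N h vv P eps a"
proof -
  define R where "R = (cmod (\<Sum>i<N. cnj (h $ i) * a $ i))\<^sup>2"
  define Q where "Q = (\<Sum>i<N. (cmod (h $ i))\<^sup>2 * vv i * (cmod (a $ i))\<^sup>2)"
  \<comment> \<open>The MSE contains a^H h and the margin h^H a; they are conjugate and have the
    same modulus.\<close>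
  have "(\<Sum>i<N. cnj (a $ i) * h $ i) = cnj (\<Sum>i<N. cnj (h $ i) * a $ i)"
    by (simp add: mult.commute)
  then have "Re (quad_form (outer_self h) a) = R"
    unfolding R_def quad_form_outer_self[OF assms(1) a] by (simp only: complex_mod_cnj) simp
  then have mse: "MSE N h vw vv P a = (1 - P * R / (Q + P * R + vw)) * P"
    by (simp add: MSE_def quad_form_HVH[OF a] Q_def)
  have "Q \<ge> 0" unfolding Q_def using assms(2) by (auto intro!: sum_nonneg)
  moreover have "P * R \<ge> 0" using assms(4) by (simp add: R_def)
  ultimately have S: "Q + P * R + vw > 0" using assms(3) by simp
  then have "MSE N h vw vv P a = (Q + vw) * P / (Q + P * R + vw)"
    unfolding mse by (simp add: field_simps)
  then have "MSE N h vw vv P a \<le> eps \<longleftrightarrow> (Q + vw) * P \<le> (Q + P * R + vw) * eps"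
    using S by (simp add: pos_divide_le_eq mult.commute)
  also have "\<dots> \<longleftrightarrow> (Q + vw) * P / eps \<le> Q + P * R + vw"
    using assms(5) by (simp add: pos_divide_le_eq)
  also have "\<dots> \<longleftrightarrow> (P / eps - 1) * vw \<le> P * R - (P / eps - 1) * Q"
    by (simp add: algebra_simps add_divide_distrib)
  finally show ?thesis by (simp add: snr_margin_def R_def Q_def)
qed

end

section \<open>Scaling, slack, and the equality case of the phase bound\<close>

lemma snr_margin_smult:
  assumes "a \<in> carrier_vec N"
  shows "snr_margin N h vv P eps (complex_of_real s \<cdot>\<^sub>v a) = s\<^sup>2 * snr_margin N h vv P eps a"
proof -
  have "(\<Sum>i<N. cnj (h $ i) * (complex_of_real s \<cdot>\<^sub>v a) $ i)
      = complex_of_real s * (\<Sum>i<N. cnj (h $ i) * a $ i)"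
    using assms by (auto simp: sum_distrib_left mult_ac intro!: sum.cong)
  moreover have "(\<Sum>i<N. (cmod (h $ i))\<^sup>2 * vv i * (cmod ((complex_of_real s \<cdot>\<^sub>v a) $ i))\<^sup>2)
      = s\<^sup>2 * (\<Sum>i<N. (cmod (h $ i))\<^sup>2 * vv i * (cmod (a $ i))\<^sup>2)"
    using assms
    by (auto simp: sum_distrib_left norm_mult power_mult_distrib mult_ac intro!: sum.cong)
  ultimately show ?thesis
    by (simp add: snr_margin_def norm_mult power_mult_distrib algebra_simps)
qed

text \<open>Margin and powers are both homogeneous of degree two. With slack, \<open>a\<close> could
  be shrunk until the margin meets the threshold, and its lift would be feasible with objective
  below the lower bound \<open>t\<close>.\<close>

lemma no_slack_at_minimum:
  assumes h: "h \<in> carrier_vec N" and pos: "0 < (P / eps - 1) * vw"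
    and vs: "\<forall>i<N. vth + vv i > 0"
    and opt: "\<And>B. sdp_feasible N h vth vw vv P eps B \<Longrightarrow> t \<le> sdp_objective N B"
    and a: "a \<in> carrier_vec N" and pow: "\<forall>i<N. (cmod (a $ i))\<^sup>2 * (vth + vv i) \<le> t"
    and t: "t \<ge> 0"
  shows "snr_margin N h vv P eps a \<le> (P / eps - 1) * vw"
proof (rule ccontr)
  define m where "m = (P / eps - 1) * vw"
  define g where "g = snr_margin N h vv P eps a"
  assume "\<not> ?thesis"
  then have mg: "0 < m" "m < g" using pos by (auto simp: m_def g_def)
  \<comment> \<open>This factor brings the margin from g down to exactly m.\<close>
  define s where "s = sqrt (m / g)"
  have s2: "s\<^sup>2 = m / g" "m / g < 1" "0 \<le> m / g" using mg by (auto simp: s_def)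
  \<comment> \<open>Needed for s^2 t < t to be strict: t = 0 would make all gains, and hence the
    margin g, vanish.\<close>
  have "t \<noteq> 0"
  proof
    assume "t = 0"
    have "a $ i = 0" if "i < N" for i
      using pow vs that \<open>t = 0\<close> by (fastforce simp: mult_le_0_iff)
    then have "g = 0" by (simp add: g_def snr_margin_def)
    then show False using mg by simp
  qed
  let ?b = "complex_of_real s \<cdot>\<^sub>v a"
  have b: "?b \<in> carrier_vec N" using a by simp
  have "m \<le> snr_margin N h vv P eps ?b"
    using mg s2 by (simp add: snr_margin_smult[OF a] flip: g_def)
  moreover have "(cmod (?b $ i))\<^sup>2 * (vth + vv i) \<le> s\<^sup>2 * t" if "i < N" for i
  proof -
    have "(cmod (?b $ i))\<^sup>2 * (vth + vv i) = s\<^sup>2 * ((cmod (a $ i))\<^sup>2 * (vth + vv i))"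
      using that a by (simp add: norm_mult power_mult_distrib)
    also have "\<dots> \<le> s\<^sup>2 * t"
      using pow that by (intro mult_left_mono) auto
    finally show ?thesis .
  qed
  ultimately have "sdp_feasible N h vth vw vv P eps (lift_mat N ?b (s\<^sup>2 * t))"
    using t by (simp add: sdp_feasible_lift[OF b h] m_def)
  then have "t \<le> s\<^sup>2 * t"
    using opt sdp_objective_lift[OF b] by metis
  moreover have "s\<^sup>2 * t < 1 * t"
    using s2 t \<open>t \<noteq> 0\<close> by (intro mult_strict_right_mono) auto
  ultimately show False by simp
qed

text \<open>Equality holds throughout Re w \<le> |w| \<le> |h| r |k| for w = cnj h z k. So w is the
  real number |h| r |k|, and multiplying by h and cnj k recovers z.\<close>

lemma eq_of_phase_equality:
  fixes h k z :: complex
  assumes "h \<noteq> 0" "k \<noteq> 0" "cmod z \<le> r"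
    and "Re (cnj h * z * k) = cmod h * r * cmod k"
  shows "z = complex_of_real r * (sgn h * cnj (sgn k))"
proof -
  let ?w = "cnj h * z * k"
  have "cmod ?w \<le> Re ?w"
    unfolding assms(4) using assms(3) by (simp add: norm_mult mult_left_mono mult_right_mono)
  then have "cmod ?w = Re ?w"
    using complex_Re_le_cmod[of ?w] by linarith
  then have "Im ?w = 0"
    using cmod_eq_Re cmod_power2[of ?w] by simp
  then have "?w = complex_of_real (cmod h * r * cmod k)"
    using assms(4) by (simp add: complex_eq_iff)
  moreover have "h * ?w * cnj k = complex_of_real ((cmod h)\<^sup>2 * (cmod k)\<^sup>2) * z"
    unfolding of_real_mult complex_norm_square by (simp add: mult_ac)
  ultimately have "complex_of_real ((cmod h)\<^sup>2 * (cmod k)\<^sup>2) * z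
      = complex_of_real ((cmod h)\<^sup>2 * (cmod k)\<^sup>2)
        * (complex_of_real r * (sgn h * cnj (sgn k)))"
    using assms(1,2) by (simp add: sgn_eq power2_eq_square mult_ac)
  then show ?thesis using assms(1,2) by simp
qed

section \<open>From the optimal matrix to an optimal gain vector\<close>

theorem theorem3:
  fixes N :: nat and h :: "complex vec" and vth vw P eps :: real
    and vv :: "nat \<Rightarrow> real" and A :: "complex mat"
  assumes "N \<ge> 1"
    and "h \<in> carrier_vec N" and "\<forall>i<N. h $ i \<noteq> 0"
    and "vth > 0" and "vw > 0" and "\<forall>i<N. vv i > 0" and "P > 0"
    and "P / (1 + (\<Sum>i<N. 1 / vv i) * P) < eps" and "eps < P"
    and "is_arg_min (sdp_objective N) (sdp_feasible N h vth vw vv P eps) A"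
  shows "vec_space.rank N (leading_principal N A) = 1 \<and>
    (\<exists>a \<in> carrier_vec N. leading_principal N A = outer_self a \<and>
       is_arg_min (max_power N vth vv)
         (\<lambda>b. b \<in> carrier_vec N \<and> MSE N h vw vv P b \<le> eps) a)"
proof -
  note h = assms(2)
  let ?k = "P / eps - 1"
  \<comment> \<open>The lower limit for \<open>eps\<close> is positive, so \<open>eps > 0\<close>;
    with \<open>eps < P\<close> the threshold \<open>?k * vw\<close> is then strictly
    positive.\<close>
  have "(\<Sum>i<N. 1 / vv i) \<ge> 0"
    using assms(6) by (auto intro!: sum_nonneg simp: less_imp_le)
  then have "P / (1 + (\<Sum>i<N. 1 / vv i) * P) > 0"
    using assms(7) by (intro divide_pos_pos add_pos_nonneg mult_nonneg_nonneg) auto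
  then have eps: "eps > 0" using assms(8) by linarith
  then have kvw: "?k * vw > 0" using assms(5,9) by simp
  have vs: "\<forall>i<N. vth + vv i > 0" using assms(4,6) by (auto intro: add_pos_pos)
  have feas: "sdp_feasible N h vth vw vv P eps A"
    and opt: "\<And>B. sdp_feasible N h vth vw vv P eps B \<Longrightarrow> sdp_objective N A \<le> sdp_objective N B"
    using assms(10) by (auto simp: is_arg_min_linorder)
  have psd: "pos_semidef (N + 1) A" using feas by (simp add: sdp_feasible_def)
  then have A: "A \<in> carrier_mat (N + 1) (N + 1)" by (simp add: pos_semidef_def)
  define t where "t = sdp_objective N A"
  have t_eq: "t = Re (A $$ (N, N))" by (simp add: t_def sdp_objective_eq[OF A])
  have t: "t \<ge> 0" using pos_semidef_diag(1)[OF psd, of N] by (simp add: t_eq)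
  define c where "c i = sqrt (Re (A $$ (i, i)))" for i
  have c: "c i \<ge> 0" "(c i)\<^sup>2 = Re (A $$ (i, i))" if "i < N" for i
    using pos_semidef_diag(1)[OF psd, of i] that by (auto simp: c_def)
  define a where "a = vec N (\<lambda>i. complex_of_real (c i) * sgn (h $ i))"
  have a: "a \<in> carrier_vec N" by (simp add: a_def)
  have cmod_a: "cmod (a $ i) = c i" if "i < N" for i
    using that c assms(3) by (simp add: a_def norm_mult norm_sgn)
  \<comment> \<open>\<open>?f\<close> sums to the real part of h^H X h and \<open>?g\<close> to |h^H
    a|^2; they are compared term by term.\<close>
  let ?f = "\<lambda>i j. Re (cnj (h $ i) * A $$ (i, j) * h $ j)"
  let ?g = "\<lambda>i j. cmod (h $ i) * (c i * c j) * cmod (h $ j)"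
  have bound: "cmod (A $$ (i, j)) \<le> c i * c j" if "i < N" "j < N" for i j
    using pos_semidef_offdiag[OF psd, of i j] that by (simp add: c_def)
  have fg: "?f i j \<le> ?g i j" if "i < N" "j < N" for i j
  proof -
    have "?f i j \<le> cmod (cnj (h $ i) * A $$ (i, j) * h $ j)" by (rule complex_Re_le_cmod)
    also have "\<dots> \<le> ?g i j"
      using bound[OF that] by (simp add: norm_mult mult_left_mono mult_right_mono)
    finally show ?thesis .
  qed
  \<comment> \<open>After phase alignment all terms of h^H a are nonnegative reals, so its modulus
    is the plain sum of the moduli.\<close>
  have "cnj (h $ i) * a $ i = complex_of_real (cmod (h $ i) * c i)" if "i < N" for i
    using that assms(3) complex_norm_square[of "h $ i"]
    by (simp add: a_def sgn_eq field_simps power2_eq_square)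
  then have "(\<Sum>i<N. cnj (h $ i) * a $ i) = complex_of_real (\<Sum>i<N. cmod (h $ i) * c i)"
    unfolding of_real_sum by (intro sum.cong) auto
  then have "(cmod (\<Sum>i<N. cnj (h $ i) * a $ i))\<^sup>2 = (\<Sum>i<N. cmod (h $ i) * c i)\<^sup>2"
    by (simp only: norm_of_real power2_abs)
  also have "\<dots> = (\<Sum>i<N. \<Sum>j<N. ?g i j)"
    by (simp add: power2_eq_square sum_product mult_ac)
  finally have margin_a: "snr_margin N h vv P eps a
      = P * (\<Sum>i<N. \<Sum>j<N. ?g i j) - ?k * (\<Sum>i<N. (cmod (h $ i))\<^sup>2 * vv i * Re (A $$ (i, i)))"
    unfolding snr_margin_def by (simp add: cmod_a c(2))
  have trE: "?k * vw \<le> P * (\<Sum>i<N. \<Sum>j<N. ?f i j)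
      - ?k * (\<Sum>i<N. (cmod (h $ i))\<^sup>2 * vv i * Re (A $$ (i, i)))"
    using feas by (simp add: sdp_feasible_def trace_E_tilde[OF A h])
  have row: "(\<Sum>j<N. ?f i j) \<le> (\<Sum>j<N. ?g i j)" if "i < N" for i
    using fg that by (intro sum_mono) auto
  then have sums_le: "(\<Sum>i<N. \<Sum>j<N. ?f i j) \<le> (\<Sum>i<N. \<Sum>j<N. ?g i j)"
    by (rule sum_mono) (simp only: lessThan_iff)
  have pow: "(cmod (a $ i))\<^sup>2 * (vth + vv i) \<le> t" if "i < N" for i
    using feas that by (simp add: cmod_a c(2) t_eq sdp_feasible_def trace_F_mat[OF A])
  have "snr_margin N h vv P eps a \<le> ?k * vw"
    by (rule no_slack_at_minimum[OF h kvw vs _ a _ t]) (use opt pow in \<open>auto simp: t_def\<close>)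
  \<comment> \<open>\<open>trE\<close> and \<open>margin_a\<close> contain the same diagonal sum,
    which cancels.\<close>
  then have "P * (\<Sum>i<N. \<Sum>j<N. ?g i j) \<le> P * (\<Sum>i<N. \<Sum>j<N. ?f i j)"
    using trE margin_a by linarith
  then have sums_eq: "(\<Sum>i<N. \<Sum>j<N. ?f i j) = (\<Sum>i<N. \<Sum>j<N. ?g i j)"
    using sums_le assms(7) by simp
  have margin: "?k * vw \<le> snr_margin N h vv P eps a"
    using trE unfolding margin_a sums_eq .
  \<comment> \<open>Equal totals of termwise ordered sums force equality, first of each row sum and
    then of each entry.\<close>
  have f_eq_g: "?f i j = ?g i j" if "i < N" "j < N" for i j
  proof -
    have "(\<Sum>j<N. ?f i j) = (\<Sum>j<N. ?g i j)"
      using row that by (intro sum_mono_inv[OF sums_eq _ _ finite_lessThan]) (simp_all only: lessThan_iff)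
    then show ?thesis
      using fg that by (intro sum_mono_inv[OF _ _ _ finite_lessThan]) (simp_all only: lessThan_iff)
  qed
  have lead: "leading_principal N A = outer_self a"
  proof (rule eq_matI)
    fix i j assume "i < dim_row (outer_self a)" "j < dim_col (outer_self a)"
    then have ij: "i < N" "j < N" using a by (auto simp: outer_self_def)
    have "A $$ (i, j) = complex_of_real (c i * c j) * (sgn (h $ i) * cnj (sgn (h $ j)))"
      by (rule eq_of_phase_equality[OF _ _ bound[OF ij] f_eq_g[OF ij]]) (use assms(3) ij in auto)
    also have "\<dots> = a $ i * cnj (a $ j)" using ij by (simp add: a_def)
    finally show "leading_principal N A $$ (i, j) = outer_self a $$ (i, j)"
      using ij a by (simp add: leading_principal_def)
  qed (use a in \<open>auto simp: leading_principal_def outer_self_def\<close>)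
  \<comment> \<open>The zero vector has margin 0, below the positive threshold.\<close>
  have "a \<noteq> 0\<^sub>v N"
    using margin kvw by (auto simp: snr_margin_def)
  then have rank: "vec_space.rank N (leading_principal N A) = 1"
    unfolding lead by (rule rank_outer_self[OF a])
  have "max_power N vth vv a \<le> t"
    unfolding max_power_def using pow assms(1) by (subst Max_le_iff) (auto simp: lessThan_empty_iff)
  moreover have "t \<le> max_power N vth vv b"
    if b: "b \<in> carrier_vec N" and "MSE N h vw vv P b \<le> eps" for b
  proof -
    have le: "(cmod (b $ i))\<^sup>2 * (vth + vv i) \<le> max_power N vth vv b" if "i < N" for i
      unfolding max_power_def using that by (intro Max_ge) auto
    \<comment> \<open>Sensor 0 exists since \<open>N \<ge> 1\<close>; its power shows that the
      maximum is nonnegative, as the last diagonal entry of a lift has to be.\<close>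
    have "0 \<le> (cmod (b $ 0))\<^sup>2 * (vth + vv 0)"
      using vs assms(1) by (simp add: less_imp_le)
    also have "\<dots> \<le> max_power N vth vv b"
      using le assms(1) by simp
    finally have "0 \<le> max_power N vth vv b" .
    then have "sdp_feasible N h vth vw vv P eps (lift_mat N b (max_power N vth vv b))"
      using le that MSE_le_iff[OF b h assms(6,5,7) eps] by (simp add: sdp_feasible_lift[OF b h])
    then show ?thesis
      using opt unfolding t_def by (metis sdp_objective_lift[OF b])
  qed
  moreover have "MSE N h vw vv P a \<le> eps"
    using margin MSE_le_iff[OF a h assms(6,5,7) eps] by simp
  \<comment> \<open>The optimal value \<open>t\<close> lies between the maximal power of
    \<open>a\<close> and that of every admissible \<open>b\<close>.\<close>
  ultimately have "is_arg_min (max_power N vth vv)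
      (\<lambda>b. b \<in> carrier_vec N \<and> MSE N h vw vv P b \<le> eps) a"
    using a by (auto simp: is_arg_min_linorder intro: order_trans)
  then show ?thesis using a lead rank by blast
qed

end
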